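(* Let $(\Omega,\mathcal F,P)$ be a probability space, $T:\Omega\to\Omega$ an ergodic measure-preserving map, and $\mathcal F_0\subseteq\mathcal F_1\subseteq\dots\subseteq\mathcal F$ a family of $\sigma$-algebras such that, for each $t\ge 0$, $T^{-1}(\Gamma)\in\mathcal F_{t+1}$ if and only if $\Gamma\in\mathcal F_t$. Let $K\ge1$, let $\Delta=\{v=(v_1,\dots,v_K)\ge0:\sum_{k}v_k=1\}$ be the unit simplex, and let $r\in(0,1)$. Let $R,\lambda^*:\Omega\to\Delta$ be such that the stationary processes $R_t(\omega)=R(T^t\omega)$ and $\lambda^*_t(\omega)=\lambda^*(T^t\omega)$, $t=0,1,2,\dots$, are adapted to $(\mathcal F_t)$, and suppose that $$r\,E_0\lambda^*(T\omega)+(1-r)\,E_0R(T\omega)=\lambda^*(\omega)\quad\text{(a.s.)},$$ where $E_0(\cdot)=E(\cdot\,|\,\mathcal F_0)$. Denote by $R_{t,k}$ and $\lambda^*_{t,k}$ the coordinates of $R_t$ and $\lambda^*_t$, and put $\lambda^*_k:=\lambda^*_{0,k}$. Assume: (K1) $E\ln\min_k\lambda^*_k>-\infty$. (K2) The random variables $\mu_k:=r\lambda^*_{1,k}+(1-r)R_{1,k}$, $k=1,\dots,K$, are conditionally linearly independent given $\mathcal F_0$, i.e. whenever $\alpha_1,\dots,\alpha_K$ are $\mathcal F_0$-measurable random variables with $\alpha_1\mu_1+\dots+\alpha_K\mu_K=0$ (a.s.), then $\alpha_1=\dots=\alpha_K=0$ (a.s.). Let $\lambda:\Omega\to\Delta$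 be such that the stationary process $\lambda_t(\omega)=\lambda(T^t\omega)$ is adapted to $(\mathcal F_t)$ (a strategy), with coordinates $\lambda_{t,k}$, and suppose $\lambda\ne\lambda^*$ (that is, it is not the case that $\lambda=\lambda^*$ a.s.). For $a\ge0$ let $(x_t^a)_{t\ge0}$ be the random sequence defined by $x_0^a=a$ and, for $t\ge 0$ with $x_t=x_t^a$, $$x_{t+1}=x_t\,\frac{\sum_{k=1}^K\left[r\lambda^*_{t+1,k}+(1-r)R_{t+1,k}\right]\dfrac{\lambda_{t,k}}{\lambda_{t,k}x_t+\lambda^*_{t,k}}}{\sum_{k=1}^K\left[r\lambda_{t+1,k}+(1-r)R_{t+1,k}\right]\dfrac{\lambda^*_{t,k}}{\lambda_{t,k}x_t+\lambda^*_{t,k}}}.$$ Then there exist a random variable $\gamma(\omega)>0$ and a constant $c<0$ such that, with probability one (i.e. for all $\omega$ in a set of full measure not depending on $a$), $$\limsup_{t\to\infty}\frac1t\ln x_t^a\le c\quad\text{for all }0\le a\le\gamma(\omega).$$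
   Context: $E$ denotes expectation with respect to $P$. $T$ measure-preserving means $T$ is $\mathcal F$-measurable and $P(T^{-1}(\Gamma))=P(\Gamma)$ for all $\Gamma\in\mathcal F$ (not necessarily invertible); ergodic means every $T$-invariant set has measure $0$ or $1$. A process $(Y_t)$ is adapted to $(\mathcal F_t)$ if $Y_t$ is $\mathcal F_t$-measurable for each $t$; conditional expectations of vectors are taken coordinatewise. Convention: $\ln 0=-\infty$. By (K1), $\min_k\lambda^*_{t,k}>0$ for all $t$ almost surely, so the recursion defining $x_t^a$ for $a\ge0$ is well defined almost surely (on the exceptional null set it may be defined arbitrarily). *)

theory Defs
  imports "HOL-Probability.Probability"
begin

definition measure_preserving :: "'a measure \<Rightarrow> ('a \<Rightarrow> 'a) \<Rightarrow> bool" where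
  "measure_preserving M T \<longleftrightarrow>
     T \<in> measurable M M \<and> (\<forall>A\<in>sets M. emeasure M (T -` A \<inter> space M) = emeasure M A)"

definition ergodic :: "'a measure \<Rightarrow> ('a \<Rightarrow> 'a) \<Rightarrow> bool" where
  "ergodic M T \<longleftrightarrow>
     (\<forall>A\<in>sets M. T -` A \<inter> space M = A \<longrightarrow> measure M A = 0 \<or> measure M A = 1)"

definition unit_simplex :: "(real ^ 'k) set" where
  "unit_simplex = {v. (\<forall>k. 0 \<le> v $ k) \<and> (\<Sum>k\<in>UNIV. v $ k) = 1}"

definition stationary_process :: "('a \<Rightarrow> 'a) \<Rightarrow> ('a \<Rightarrow> 'b) \<Rightarrow> nat \<Rightarrow> 'a \<Rightarrow> 'b" where
  "stationary_process T f t \<omega> = f ((T ^^ t) \<omega>)"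

definition adapted :: "(nat \<Rightarrow> 'a measure) \<Rightarrow> (nat \<Rightarrow> 'a \<Rightarrow> 'b::topological_space) \<Rightarrow> bool" where
  "adapted F Y \<longleftrightarrow> (\<forall>t. Y t \<in> borel_measurable (F t))"

text \<open>The real logarithm of the library has \<open>ln 0 = 0\<close>; here \<open>ln 0 = -\<infinity>\<close>.
  The values at negative arguments are irrelevant.\<close>

definition eln :: "real \<Rightarrow> ereal" where
  "eln x = (if x \<le> 0 then - \<infinity> else ereal (ln x))"

text \<open>Expectation of an extended real random variable as the difference of the integrals of its
  positive and negative parts (\<open>e2ennreal\<close> maps negative arguments to \<open>0\<close>). It is meaningful
  only if at least one of the two integrals is finite, e.g. if \<open>f \<le> 0\<close>.\<close>

definition ereal_expectation :: "'a measure \<Rightarrow> ('a \<Rightarrow> ereal) \<Rightarrow> ereal" where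
  "ereal_expectation M f =
     enn2ereal (\<integral>\<^sup>+ \<omega>. e2ennreal (f \<omega>) \<partial>M) - enn2ereal (\<integral>\<^sup>+ \<omega>. e2ennreal (- f \<omega>) \<partial>M)"

definition cond_lin_indep ::
  "'a measure \<Rightarrow> 'a measure \<Rightarrow> ('k::finite \<Rightarrow> 'a \<Rightarrow> real) \<Rightarrow> bool" where
  "cond_lin_indep M G \<mu> \<longleftrightarrow>
     (\<forall>\<alpha> :: 'k \<Rightarrow> 'a \<Rightarrow> real.
        (\<forall>k. \<alpha> k \<in> borel_measurable G) \<longrightarrow>
        (AE \<omega> in M. (\<Sum>k\<in>UNIV. \<alpha> k \<omega> * \<mu> k \<omega>) = 0) \<longrightarrow>
        (\<forall>k. AE \<omega> in M. \<alpha> k \<omega> = 0))"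

text \<open>The argument \<open>Ls\<close> stands for \<open>\<lambda>\<^sup>*\<close> and \<open>L\<close> for \<open>\<lambda>\<close>. Where a denominator vanishes,
  the library convention \<open>x / 0 = 0\<close> supplies an arbitrary value.\<close>

primrec wealth_ratio ::
  "real \<Rightarrow> ('a \<Rightarrow> 'a) \<Rightarrow> ('a \<Rightarrow> real ^ 'k) \<Rightarrow> ('a \<Rightarrow> real ^ 'k) \<Rightarrow> ('a \<Rightarrow> real ^ 'k::finite) \<Rightarrow>
    real \<Rightarrow> nat \<Rightarrow> 'a \<Rightarrow> real" where
  "wealth_ratio r T R Ls L a 0 \<omega> = a"
| "wealth_ratio r T R Ls L a (Suc t) \<omega> =
    (let x = wealth_ratio r T R Ls L a t \<omega>;
         Rt = (\<lambda>t. stationary_process T R t \<omega>);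
         Lst = (\<lambda>t. stationary_process T Ls t \<omega>);
         Lt = (\<lambda>t. stationary_process T L t \<omega>)
     in x *
        ((\<Sum>k\<in>UNIV. (r * Lst (t + 1) $ k + (1 - r) * Rt (t + 1) $ k) *
            (Lt t $ k / (Lt t $ k * x + Lst t $ k))) /
         (\<Sum>k\<in>UNIV. (r * Lt (t + 1) $ k + (1 - r) * Rt (t + 1) $ k) *
            (Lst t $ k / (Lt t $ k * x + Lst t $ k)))))"

end

theory Submission
  imports Defs
begin

text \<open>Write \<open>\<mu>\<^sub>k\<close> for the variables in (K2), \<open>m = min\<^sub>k \<lambda>\<^sup>*\<^sub>k\<close>
  and \<open>d = \<Sum>\<^sub>k \<mu>\<^sub>k \<lambda>\<^sub>k / \<lambda>\<^sup>*\<^sub>k\<close>, the growth factor of the linearisation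
  at \<open>0\<close>. The recursion satisfies \<open>x\<^sub>t\<^sub>+\<^sub>1 \<le> x\<^sub>t d(T\<^sup>t\<omega>) (1 + x\<^sub>t / m(T\<^sup>t\<omega>))\<close>.
  Since \<open>E\<^sub>0 \<mu>\<^sub>k = \<lambda>\<^sup>*\<^sub>k\<close>, we have \<open>E d = 1\<close>, so Jensen's inequality for the logarithm gives
  \<open>E ln d < 0\<close>; equality is impossible, because \<open>d = 1\<close> means
  \<open>\<Sum>\<^sub>k (\<lambda>\<^sub>k / \<lambda>\<^sup>*\<^sub>k - 1) \<mu>\<^sub>k = 0\<close> and (K2) would force \<open>\<lambda> = \<lambda>\<^sup>*\<close>.
  By ergodicity the linearised products decay exponentially, while \<open>1 / m(T\<^sup>t\<omega>)\<close> grows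
  subexponentially by (K1). A small enough initial value therefore keeps all the products
  \<open>\<Prod> (1 + x\<^sub>t / m(T\<^sup>t\<omega>))\<close> bounded.\<close>

section \<open>Measure-preserving maps and their iterates\<close>

lemma measure_preserving_measurable:
  "measure_preserving M T \<Longrightarrow> T \<in> measurable M M"
  by (simp add: measure_preserving_def)

lemma measure_preserving_distr:
  assumes "measure_preserving M T"
  shows "distr M M T = M"
  using assms by (intro measure_eqI) (auto simp: measure_preserving_def emeasure_distr)

lemma measure_preserving_integral:
  fixes f :: "'a \<Rightarrow> real"
  assumes "measure_preserving M T" and "f \<in> borel_measurable M"
  shows "integrable M (\<lambda>\<omega>. f (T \<omega>)) \<longleftrightarrow> integrable M f"
    and "(\<integral>\<omega>. f (T \<omega>) \<partial>M) = (\<integral>\<omega>. f \<omega> \<partial>M)"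
  using integrable_distr_eq[OF measure_preserving_measurable[OF assms(1)] assms(2)]
    integral_distr[OF measure_preserving_measurable[OF assms(1)] assms(2)]
  by (simp_all add: measure_preserving_distr[OF assms(1)])

lemma measure_preserving_AE:
  assumes "measure_preserving M T" and "AE \<omega> in M. P \<omega>"
  shows "AE \<omega> in M. P (T \<omega>)"
proof -
  have "AE \<omega> in distr M M T. P \<omega>"
    unfolding measure_preserving_distr[OF assms(1)] by (rule assms(2))
  then show ?thesis
    by (rule AE_distrD[OF measure_preserving_measurable[OF assms(1)]])
qed

lemma measurable_funpow:
  assumes "T \<in> measurable M M"
  shows "T ^^ n \<in> measurable M M"
proof (induction n)
  case 0 then show ?case by (simp add: id_def)
next
  case (Suc n) then show ?case using assms by (simp only: funpow.simps) (rule measurable_comp)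
qed

lemma AE_funpow:
  assumes "measure_preserving M T" and "AE \<omega> in M. P \<omega>"
  shows "AE \<omega> in M. \<forall>n. P ((T ^^ n) \<omega>)"
proof -
  have "AE \<omega> in M. P ((T ^^ n) \<omega>)" for n
  proof (induction n)
    case 0 then show ?case using assms(2) by simp
  next
    case (Suc n)
    from measure_preserving_AE[OF assms(1) this] show ?case
      by (simp add: funpow_swap1)
  qed
  then show ?thesis by (simp add: AE_all_countable)
qed

section \<open>Birkhoff sums and one-sided ergodic bounds\<close>

text \<open>This is the maximum over \<open>0 \<le> m \<le> n\<close> of the Birkhoff sums of length
  \<open>m\<close>. The recursion peels off the first term of the orbit, which makes
  \<open>max_sum T g (Suc n)\<close> directly comparable with \<open>max_sum T g n\<close> at
  \<open>T \<omega>\<close>.\<close>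

primrec max_sum :: "('a \<Rightarrow> 'a) \<Rightarrow> ('a \<Rightarrow> real) \<Rightarrow> nat \<Rightarrow> 'a \<Rightarrow> real" where
  "max_sum T g 0 \<omega> = 0"
| "max_sum T g (Suc n) \<omega> = max 0 (g \<omega> + max_sum T g n (T \<omega>))"

lemma max_sum_nonneg: "0 \<le> max_sum T g n \<omega>"
  by (cases n) auto

lemma max_sum_le_Suc: "max_sum T g n \<omega> \<le> max_sum T g (Suc n) \<omega>"
proof (induction n arbitrary: \<omega>)
  case 0 then show ?case by simp
next
  case (Suc n)
  from Suc[of "T \<omega>"] show ?case
    unfolding max_sum.simps(2)[of T g "Suc n"] max_sum.simps(2)[of T g n \<omega>] by simp
qed

lemma max_sum_mono: "m \<le> n \<Longrightarrow> max_sum T g m \<omega> \<le> max_sum T g n \<omega>"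
  by (rule lift_Suc_mono_le[of "\<lambda>n. max_sum T g n \<omega>"]) (rule max_sum_le_Suc)

lemma sum_le_max_sum: "(\<Sum>i<n. g ((T ^^ i) \<omega>)) \<le> max_sum T g n \<omega>"
proof (induction n arbitrary: \<omega>)
  case 0 then show ?case by simp
next
  case (Suc n)
  have "(\<Sum>i<Suc n. g ((T ^^ i) \<omega>)) = g \<omega> + (\<Sum>i<n. g ((T ^^ i) (T \<omega>)))"
    unfolding sum.lessThan_Suc_shift by (simp add: funpow_swap1)
  with Suc[of "T \<omega>"] show ?case by simp
qed

lemma integrable_max_sum:
  assumes T: "measure_preserving M T" and g: "integrable M g"
  shows "integrable M (max_sum T g n)"
proof (induction n)
  case 0 then show ?case by (simp add: max_sum.simps(1)[abs_def])
next
  case (Suc n)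
  then have "integrable M (\<lambda>\<omega>. max_sum T g n (T \<omega>))"
    using measure_preserving_integral(1)[OF T] by blast
  then show ?case
    using g by (simp add: max_sum.simps(2)[abs_def])
qed

text \<open>A one-sided form of Birkhoff's theorem, by the argument of the maximal ergodic theorem: were the
  sums unbounded almost everywhere, \<open>max_sum T g (n + 1) - max_sum T g n \<circ> T\<close>, whose integral is
  nonnegative by invariance, would converge to \<open>g\<close>.\<close>

theorem ergodic_sums_bounded_above:
  assumes M: "prob_space M" and T: "measure_preserving M T" and erg: "ergodic M T"
    and g: "integrable M g" and neg: "(\<integral>\<omega>. g \<omega> \<partial>M) < 0"
  shows "AE \<omega> in M. \<exists>C::nat. \<forall>n. (\<Sum>i<n. g ((T ^^ i) \<omega>)) \<le> real C"
proof -
  interpret prob_space M by fact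
  note [measurable] = measure_preserving_measurable[OF T]
    measurable_funpow[OF measure_preserving_measurable[OF T]] borel_measurable_integrable[OF g]
  define S where "S n \<omega> = (\<Sum>i<n. g ((T ^^ i) \<omega>))" for n \<omega>
  have S_Suc: "S (Suc n) \<omega> = g \<omega> + S n (T \<omega>)" for n \<omega>
    unfolding S_def sum.lessThan_Suc_shift by (simp add: funpow_swap1)
  have [measurable]: "S n \<in> borel_measurable M" for n
    unfolding S_def[abs_def] by measurable
  define A where "A = {\<omega> \<in> space M. \<forall>C::nat. \<exists>n. S n \<omega> > real C}"
  have A_sets: "A \<in> sets M" unfolding A_def by measurable
  \<comment> \<open>The sums along the orbits of \<omega> and \<open>T \<omega>\<close> differ by
    the single finite term \<open>g \<omega>\<close>. Hence \<open>A\<close> is invariant exactly,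
    not just up to null sets, as \<open>ergodic\<close> requires.\<close>
  have unbounded_T: "(\<forall>C::nat. \<exists>n. S n (T \<omega>) > real C) \<longleftrightarrow> (\<forall>C::nat. \<exists>n. S n \<omega> > real C)" for \<omega>
  proof (intro iffI allI)
    fix C :: nat
    assume *: "\<forall>C::nat. \<exists>n. S n (T \<omega>) > real C"
    obtain D :: nat where D: "real D \<ge> real C - g \<omega>" using real_arch_simple by blast
    obtain n where "S n (T \<omega>) > real D" using * by blast
    then have "S (Suc n) \<omega> > real C" using D by (simp add: S_Suc)
    then show "\<exists>n. S n \<omega> > real C" by blast
  next
    fix C :: nat
    assume *: "\<forall>C::nat. \<exists>n. S n \<omega> > real C"
    obtain D :: nat where D: "real D \<ge> real C + \<bar>g \<omega>\<bar>" using real_arch_simple by blast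
    obtain n where n: "S n \<omega> > real D" using * by blast
    then have "n \<noteq> 0" using D by (intro notI) (simp add: S_def)
    then obtain m where "n = Suc m" using not0_implies_Suc by blast
    then have "S m (T \<omega>) > real C" using n D by (simp add: S_Suc)
    then show "\<exists>n. S n (T \<omega>) > real C" by blast
  qed
  have "T -` A \<inter> space M = A"
    using unbounded_T measurable_space[OF measure_preserving_measurable[OF T]]
    by (auto simp: A_def)
  with erg A_sets have "prob A = 0 \<or> prob A = 1" by (auto simp: ergodic_def)
  moreover have "prob A \<noteq> 1"
  proof
    assume "prob A = 1"
    then have "AE \<omega> in M. \<omega> \<in> A" using A_sets by (simp add: prob_eq_1)
    \<comment> \<open>This is the difference
      \<open>max_sum T g (Suc n) \<omega> - max_sum T g n (T \<omega>)\<close> with the subtraction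
      carried into the \<open>max\<close>. In this form both the domination by
      \<open>\<bar>g\<bar>\<close> and the equality with \<open>g\<close> for large
      \<open>max_sum\<close> can be read off.\<close>
    define d where "d n \<omega> = max (- max_sum T g n (T \<omega>)) (g \<omega>)" for n \<omega>
    have mx_int: "integrable M (max_sum T g n)" for n
      by (rule integrable_max_sum[OF T g])
    have mxT: "integrable M (\<lambda>\<omega>. max_sum T g n (T \<omega>))"
      "(\<integral>\<omega>. max_sum T g n (T \<omega>) \<partial>M) = (\<integral>\<omega>. max_sum T g n \<omega> \<partial>M)" for n
      using measure_preserving_integral[OF T borel_measurable_integrable[OF mx_int]] mx_int by auto
    have [measurable]: "d n \<in> borel_measurable M" for n
      unfolding d_def[abs_def]
      using borel_measurable_integrable[OF mxT(1)] by measurable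
    have d_eq: "d n \<omega> = max_sum T g (Suc n) \<omega> - max_sum T g n (T \<omega>)" for n \<omega>
      by (simp add: d_def max_def)
    have d_nonneg: "0 \<le> (\<integral>\<omega>. d n \<omega> \<partial>M)" for n
    proof -
      have "(\<integral>\<omega>. d n \<omega> \<partial>M) = (\<integral>\<omega>. max_sum T g (Suc n) \<omega> \<partial>M) - (\<integral>\<omega>. max_sum T g n (T \<omega>) \<partial>M)"
        unfolding d_eq using mx_int[of "Suc n"] mxT(1)[of n]
        by (simp del: max_sum.simps)
      moreover have "(\<integral>\<omega>. max_sum T g n (T \<omega>) \<partial>M) \<le> (\<integral>\<omega>. max_sum T g (Suc n) \<omega> \<partial>M)"
        unfolding mxT(2) by (rule integral_mono[OF mx_int mx_int max_sum_le_Suc])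
      ultimately show ?thesis by simp
    qed
    have "(\<lambda>n. \<integral>\<omega>. d n \<omega> \<partial>M) \<longlonglongrightarrow> (\<integral>\<omega>. g \<omega> \<partial>M)"
    proof (rule integral_dominated_convergence[where w = "\<lambda>\<omega>. \<bar>g \<omega>\<bar>"])
      show "AE \<omega> in M. (\<lambda>n. d n \<omega>) \<longlonglongrightarrow> g \<omega>"
        using \<open>AE \<omega> in M. \<omega> \<in> A\<close>
      proof eventually_elim
        fix \<omega> assume "\<omega> \<in> A"
        then have *: "\<forall>C::nat. \<exists>n. S n (T \<omega>) > real C"
          using unbounded_T by (auto simp: A_def)
        obtain D :: nat where D: "real D \<ge> \<bar>g \<omega>\<bar>" using real_arch_simple by blast
        obtain m where m: "S m (T \<omega>) > real D" using * by blast
        have "d n \<omega> = g \<omega>" if "n \<ge> m" for n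
        proof -
          have "real D < max_sum T g n (T \<omega>)"
            using m sum_le_max_sum[of g T "T \<omega>" m] max_sum_mono[OF that, of T g "T \<omega>"]
            by (simp add: S_def)
          then show ?thesis using D by (simp add: d_def max_def)
        qed
        then show "(\<lambda>n. d n \<omega>) \<longlonglongrightarrow> g \<omega>"
          by (intro tendsto_eventually eventually_sequentiallyI)
      qed
      show "AE \<omega> in M. norm (d n \<omega>) \<le> \<bar>g \<omega>\<bar>" for n
      proof (intro AE_I2)
        fix \<omega> show "norm (d n \<omega>) \<le> \<bar>g \<omega>\<bar>"
          using max_sum_nonneg[of T g n "T \<omega>"] by (auto simp: d_def max_def abs_if)
      qed
    qed (use g in auto)
    then have "0 \<le> (\<integral>\<omega>. g \<omega> \<partial>M)"
      by (rule LIMSEQ_le_const) (use d_nonneg in auto)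
    with neg show False by simp
  qed
  ultimately have "A \<in> null_sets M"
    using A_sets by (simp add: emeasure_eq_measure null_sets_def)
  then show ?thesis
  proof (rule AE_I')
    show "{\<omega> \<in> space M. \<not> (\<exists>C::nat. \<forall>n. (\<Sum>i<n. g ((T ^^ i) \<omega>)) \<le> real C)} \<subseteq> A"
      by (auto simp: A_def S_def not_le)
  qed
qed

text \<open>For large \<open>N\<close> the excess of \<open>h\<close> over \<open>N\<close> has mean
  below \<epsilon>, so the sums of excess minus \<epsilon> are bounded above along almost every
  orbit. The excess is nonnegative, so its value at time \<open>n\<close> is at most its sum up to
  \<open>n\<close>, which is at most a constant plus a multiple \<epsilon> of the number of
  terms.\<close>

lemma ergodic_sublinear:
  assumes M: "prob_space M" and T: "measure_preserving M T" and erg: "ergodic M T"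
    and h: "integrable M h" and "0 < \<epsilon>"
  shows "AE \<omega> in M. \<exists>C::nat. \<forall>n. h ((T ^^ n) \<omega>) \<le> real C + \<epsilon> * real n"
proof -
  interpret prob_space M by fact
  have [measurable]: "h \<in> borel_measurable M" using h by simp
  have "(\<lambda>N. \<integral>\<omega>. max 0 (h \<omega> - real N) \<partial>M) \<longlonglongrightarrow> (\<integral>\<omega>. 0 \<partial>M)"
  proof (rule integral_dominated_convergence[where w = "\<lambda>\<omega>. \<bar>h \<omega>\<bar>"])
    show "AE \<omega> in M. (\<lambda>N. max 0 (h \<omega> - real N)) \<longlonglongrightarrow> 0"
    proof (intro AE_I2 tendsto_eventually)
      fix \<omega>
      obtain m :: nat where "h \<omega> \<le> real m" using real_arch_simple by blast
      then show "\<forall>\<^sub>F N in sequentially. max 0 (h \<omega> - real N) = 0"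
        by (intro eventually_sequentiallyI[of m]) auto
    qed
  qed (use h in auto)
  then have "\<forall>\<^sub>F N in sequentially. (\<integral>\<omega>. max 0 (h \<omega> - real N) \<partial>M) < \<epsilon>"
    using \<open>0 < \<epsilon>\<close> by (intro order_tendstoD(2)) auto
  then obtain N where N: "(\<integral>\<omega>. max 0 (h \<omega> - real N) \<partial>M) < \<epsilon>"
    by (auto simp: eventually_sequentially)
  define u where "u \<omega> = max 0 (h \<omega> - real N)" for \<omega>
  have u: "integrable M u" unfolding u_def using h by auto
  have "AE \<omega> in M. \<exists>C::nat. \<forall>n. (\<Sum>i<n. u ((T ^^ i) \<omega>) - \<epsilon>) \<le> real C"
  proof (rule ergodic_sums_bounded_above[OF M T erg])
    show "integrable M (\<lambda>\<omega>. u \<omega> - \<epsilon>)" using u by simp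
    show "(\<integral>\<omega>. u \<omega> - \<epsilon> \<partial>M) < 0" using u N unfolding u_def[symmetric] by (simp add: prob_space)
  qed
  then show ?thesis
  proof eventually_elim
    fix \<omega> assume "\<exists>C::nat. \<forall>n. (\<Sum>i<n. u ((T ^^ i) \<omega>) - \<epsilon>) \<le> real C"
    then obtain C :: nat where C: "\<And>n. (\<Sum>i<n. u ((T ^^ i) \<omega>) - \<epsilon>) \<le> real C" by blast
    \<comment> \<open>The extra \<epsilon> pays for the sum up to time \<open>n\<close> having
      \<open>n + 1\<close> terms; \<open>N\<close> restores the truncated part of
      \<open>h\<close>.\<close>
    obtain B :: nat where B: "real B \<ge> real C + real N + \<epsilon>" using real_arch_simple by blast
    have "h ((T ^^ n) \<omega>) \<le> real B + \<epsilon> * real n" for n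
    proof -
      have "h ((T ^^ n) \<omega>) - real N \<le> u ((T ^^ n) \<omega>)" by (simp add: u_def)
      also have "\<dots> \<le> (\<Sum>i<Suc n. u ((T ^^ i) \<omega>))"
        by (rule member_le_sum) (auto simp: u_def)
      also have "\<dots> \<le> real C + \<epsilon> * real (Suc n)"
        using C[of "Suc n"] by (simp add: sum_subtractf algebra_simps)
      finally show ?thesis using B by (simp add: algebra_simps)
    qed
    then show "\<exists>C::nat. \<forall>n. h ((T ^^ n) \<omega>) \<le> real C + \<epsilon> * real n" by blast
  qed
qed

section \<open>Deterministic estimates: perturbed products and one step of the recursion\<close>

text \<open>The term \<open>1 - \<rho>\<^sup>t\<close> is the geometric sum bounding \<open>\<Sum>\<^sub>s\<^sub><\<^sub>t x\<^sub>s w\<^sub>s\<close>.\<close>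

lemma perturbed_product_decay:
  fixes x g w :: "nat \<Rightarrow> real" and \<epsilon> b :: real
  defines "\<rho> \<equiv> exp (- \<epsilon>)"
  assumes nonneg: "\<And>t. 0 \<le> x t"
    and step: "\<And>t. x (Suc t) \<le> x t * exp (g t) * (1 + x t * w t)"
    and w: "\<And>t. 0 \<le> w t" "\<And>t. w t \<le> exp (b + \<epsilon> * real t)"
    and g: "\<And>t. (\<Sum>i<t. g i) \<le> b - 2 * \<epsilon> * real t"
    and x0: "x 0 \<le> (1 - \<rho>) * exp (- 2 * b - 1)"
  shows "x t \<le> x 0 * exp ((\<Sum>i<t. g i) + (1 - \<rho> ^ t))"
proof (induction t)
  case 0 then show ?case by simp
next
  case (Suc t)
  have \<rho>: "0 < \<rho>" "\<rho> ^ t = exp (- \<epsilon> * real t)"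
    by (auto simp: \<rho>_def exp_of_nat_mult[symmetric] mult.commute)
  have "x t \<le> x 0 * exp ((b - 2 * \<epsilon> * real t) + 1)"
  proof (rule order_trans[OF Suc])
    have "(\<Sum>i<t. g i) + (1 - \<rho> ^ t) \<le> (b - 2 * \<epsilon> * real t) + 1"
      using g[of t] zero_le_power[of \<rho> t] \<rho>(1) by linarith
    then show "x 0 * exp ((\<Sum>i<t. g i) + (1 - \<rho> ^ t)) \<le> x 0 * exp ((b - 2 * \<epsilon> * real t) + 1)"
      by (intro mult_left_mono) (auto simp: nonneg)
  qed
  \<comment> \<open>Of the decay rate \<open>2 * \<epsilon>\<close> of the unperturbed product, half
    compensates the growth of \<open>w\<close> and half survives as \<open>\<rho> ^ t\<close>. The
    constant \<open>2 * b + 1\<close> collects one \<open>b\<close> from \<open>g\<close>, one from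
    \<open>w\<close>, and the bound 1 on the geometric sum; the smallness of \<open>x 0\<close> is
    chosen to cancel it.\<close>
  then have "x t * w t \<le> (x 0 * exp ((b - 2 * \<epsilon> * real t) + 1)) * exp (b + \<epsilon> * real t)"
    by (intro mult_mono) (auto simp: nonneg w)
  also have "\<dots> = x 0 * exp (2 * b + 1 - \<epsilon> * real t)"
    by (simp add: exp_add[symmetric] mult.assoc)
  also have "\<dots> \<le> (1 - \<rho>) * exp (- 2 * b - 1) * exp (2 * b + 1 - \<epsilon> * real t)"
    by (intro mult_right_mono x0) auto
  also have "\<dots> = (1 - \<rho>) * \<rho> ^ t"
    by (simp add: \<rho>(2) exp_add[symmetric] mult.assoc)
  \<comment> \<open>The right-hand side is the increment of \<open>1 - \<rho> ^ t\<close>, so the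
    exponent in the claim advances by exactly this amount.\<close>
  finally have xw: "x t * w t \<le> \<rho> ^ t - \<rho> ^ Suc t" by (simp add: algebra_simps)
  have "1 + x t * w t \<le> exp (x t * w t)" by (rule exp_ge_add_one_self)
  also have "\<dots> \<le> exp (\<rho> ^ t - \<rho> ^ Suc t)" using xw by simp
  finally have le: "1 + x t * w t \<le> exp (\<rho> ^ t - \<rho> ^ Suc t)" .
  have "x (Suc t) \<le> x t * exp (g t) * (1 + x t * w t)" by (rule step)
  also have "\<dots> \<le> (x 0 * exp ((\<Sum>i<t. g i) + (1 - \<rho> ^ t)) * exp (g t)) * exp (\<rho> ^ t - \<rho> ^ Suc t)"
    by (intro mult_mono mult_right_mono Suc le) (auto simp: nonneg w)
  also have "\<dots> = x 0 * exp ((\<Sum>i<Suc t. g i) + (1 - \<rho> ^ Suc t))"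
    by (simp add: exp_add[symmetric] mult.assoc)
  finally show ?case .
qed

text \<open>Dropping \<open>l k * x\<close> from the denominators bounds the numerator by its value
  at \<open>x = 0\<close>. In the denominator, \<open>l k * x \<le> x \<le> x * (s k / m)\<close>
  bounds every fraction below by \<open>1 / (1 + x / m)\<close>, and the weights \<nu> average this
  to the same bound.\<close>

lemma wealth_ratio_step_bound:
  fixes l s \<mu> \<nu> :: "'k::finite \<Rightarrow> real" and x m :: real
  assumes "0 \<le> x" "0 < m" and s: "\<And>k. m \<le> s k"
    and l: "\<And>k. 0 \<le> l k" "\<And>k. l k \<le> 1"
    and \<mu>: "\<And>k. 0 \<le> \<mu> k" and \<nu>: "\<And>k. 0 \<le> \<nu> k" "(\<Sum>k\<in>UNIV. \<nu> k) = 1"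
  defines "y \<equiv> x * ((\<Sum>k\<in>UNIV. \<mu> k * (l k / (l k * x + s k))) /
                    (\<Sum>k\<in>UNIV. \<nu> k * (s k / (l k * x + s k))))"
  shows "0 \<le> y" and "y \<le> x * (\<Sum>k\<in>UNIV. \<mu> k * (l k / s k)) * (1 + x * (1 / m))"
proof -
  have spos: "0 < s k" for k using s[of k] \<open>0 < m\<close> by linarith
  have lx: "0 \<le> l k * x" for k using l \<open>0 \<le> x\<close> by simp
  have dpos: "0 < l k * x + s k" for k using spos[of k] lx[of k] by linarith
  let ?N = "\<Sum>k\<in>UNIV. \<mu> k * (l k / (l k * x + s k))"
  let ?D = "\<Sum>k\<in>UNIV. \<nu> k * (s k / (l k * x + s k))"
  let ?d = "\<Sum>k\<in>UNIV. \<mu> k * (l k / s k)"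
  have N0: "0 \<le> ?N" using \<mu> l dpos by (intro sum_nonneg mult_nonneg_nonneg divide_nonneg_pos) auto
  have N1: "?N \<le> ?d"
    using \<mu> l spos lx by (intro sum_mono mult_left_mono divide_left_mono mult_pos_pos dpos) auto
  have q: "0 < 1 + x * (1 / m)" using assms(1,2) by (simp add: add_pos_nonneg)
  have "1 / (1 + x * (1 / m)) = (\<Sum>k\<in>UNIV. \<nu> k * (1 / (1 + x * (1 / m))))"
    by (simp only: sum_distrib_right[symmetric] \<nu> mult_1)
  also have "\<dots> \<le> ?D"
  proof (intro sum_mono mult_left_mono \<nu>(1))
    fix k
    have "l k * x \<le> x * (s k / m)"
    proof -
      have "l k * x \<le> 1 * x" using l \<open>0 \<le> x\<close> by (intro mult_right_mono)
      also have "\<dots> \<le> x * (s k / m)" using s[of k] assms(1,2)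
        by (simp add: le_divide_eq mult_left_mono)
      finally show ?thesis .
    qed
    then have "l k * x + s k \<le> s k * (1 + x * (1 / m))" by (simp add: algebra_simps)
    then show "1 / (1 + x * (1 / m)) \<le> s k / (l k * x + s k)"
      using dpos[of k] q by (simp add: divide_le_eq le_divide_eq mult.commute)
  qed
  finally have D: "1 / (1 + x * (1 / m)) \<le> ?D" .
  then have Dpos: "0 < ?D" using q by (smt (verit) divide_pos_pos)
  show "0 \<le> y" unfolding y_def using N0 Dpos \<open>0 \<le> x\<close> by simp
  have "?N / ?D \<le> ?d / (1 / (1 + x * (1 / m)))"
    using N0 N1 D q by (intro frac_le) auto
  then have "?N / ?D \<le> ?d * (1 + x * (1 / m))" by simp
  then show "y \<le> x * ?d * (1 + x * (1 / m))"
    unfolding y_def mult.assoc using \<open>0 \<le> x\<close> by (rule mult_left_mono)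
qed

section \<open>Conditional expectations, truncated logarithms and extended expectations\<close>

text \<open>For nonnegative \<open>g\<close> the negative part in \<open>real_cond_exp\<close>
  vanishes almost everywhere, leaving the nonnegative conditional expectation. Nonnegative integrals
  allow unbounded weights \<open>f\<close>, such as the ratios of the two strategies.\<close>

lemma nn_integral_mult_real_cond_exp:
  assumes "sigma_finite_subalgebra M F" and g: "integrable M g" and pos: "\<And>\<omega>. \<omega> \<in> space M \<Longrightarrow> 0 \<le> g \<omega>"
    and f: "f \<in> borel_measurable F"
  shows "(\<integral>\<^sup>+\<omega>. f \<omega> * ennreal (real_cond_exp M F g \<omega>) \<partial>M) = (\<integral>\<^sup>+\<omega>. f \<omega> * ennreal (g \<omega>) \<partial>M)"
proof -
  interpret sigma_finite_subalgebra M F by fact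
  have [measurable]: "g \<in> borel_measurable M" using g by simp
  \<comment> \<open>The weight 1 shows that the conditional expectation has a finite integral, so it
    is finite almost everywhere and its conversion to a real number loses nothing.\<close>
  have "(\<integral>\<^sup>+\<omega>. 1 * nn_cond_exp M F (\<lambda>\<omega>. ennreal (g \<omega>)) \<omega> \<partial>M) = (\<integral>\<^sup>+\<omega>. 1 * ennreal (g \<omega>) \<partial>M)"
    by (rule nn_cond_exp_intg) auto
  also have "\<dots> < \<infinity>"
    using g pos by (simp add: nn_integral_eq_integral AE_I2)
  finally have fin: "AE \<omega> in M. nn_cond_exp M F (\<lambda>\<omega>. ennreal (g \<omega>)) \<omega> \<noteq> \<infinity>"
    by (intro nn_integral_noteq_infinite) auto
  have "AE \<omega> in M. 0 = nn_cond_exp M F (\<lambda>\<omega>. ennreal (- g \<omega>)) \<omega>"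
  proof (rule nn_cond_exp_charact)
    fix A
    show "(\<integral>\<^sup>+\<omega>\<in>A. ennreal (- g \<omega>) \<partial>M) = (\<integral>\<^sup>+\<omega>\<in>A. 0 \<partial>M)"
      using pos by (intro nn_integral_cong) (simp add: ennreal_neg)
  qed auto
  with fin have "AE \<omega> in M. ennreal (real_cond_exp M F g \<omega>) = nn_cond_exp M F (\<lambda>\<omega>. ennreal (g \<omega>)) \<omega>"
    by eventually_elim (simp add: real_cond_exp_def ennreal_enn2real_if)
  then have "(\<integral>\<^sup>+\<omega>. f \<omega> * ennreal (real_cond_exp M F g \<omega>) \<partial>M)
      = (\<integral>\<^sup>+\<omega>. f \<omega> * nn_cond_exp M F (\<lambda>\<omega>. ennreal (g \<omega>)) \<omega> \<partial>M)"
    by (intro nn_integral_cong_AE) auto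
  also have "\<dots> = (\<integral>\<^sup>+\<omega>. f \<omega> * ennreal (g \<omega>) \<partial>M)"
    by (rule nn_cond_exp_intg) (use f in auto)
  finally show ?thesis .
qed

text \<open>Truncating the logarithm keeps it integrable also where \<open>d = 0\<close>. Any level strictly below \<open>-1\<close>
  preserves the equality case: at \<open>-1\<close>, equality would also hold for \<open>d = 0\<close>.\<close>

lemma ln_max_exp_le:
  fixes d :: real
  assumes "0 \<le> d"
  shows "ln (max d (exp (- 2))) \<le> d - 1"
    and "ln (max d (exp (- 2))) = d - 1 \<longleftrightarrow> d = 1"
proof -
  have eq: "ln (max d (exp (- 2))) = (if d \<le> exp (-2) then - 2 else ln d)"
    by (auto simp: max_def)
  have p: "exp (-2::real) > 0" by simp
  show "ln (max d (exp (- 2))) \<le> d - 1"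
    unfolding eq using assms ln_le_minus_one[of d] p by (auto simp del: exp_gt_zero)
  show "ln (max d (exp (- 2))) = d - 1 \<longleftrightarrow> d = 1"
    using assms p ln_eq_minus_one[of d] unfolding eq by (auto split: if_splits simp del: exp_gt_zero)
qed

lemma unit_simplexD:
  assumes "v \<in> unit_simplex"
  shows "0 \<le> v $ k" and "v $ k \<le> 1" and "(\<Sum>k\<in>UNIV. v $ k) = 1"
proof -
  show *: "0 \<le> v $ k" "(\<Sum>k\<in>UNIV. v $ k) = 1" for k
    using assms by (auto simp: unit_simplex_def)
  have "v $ k \<le> (\<Sum>k\<in>UNIV. v $ k)" by (rule member_le_sum) (auto simp: *)
  then show "v $ k \<le> 1" by (simp add: *)
qed

text \<open>Since \<open>m \<le> 1\<close>, the positive part of \<open>eln (m \<omega>)\<close> is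
  zero, so the hypothesis says that the negative part has a finite integral. It is therefore finite
  almost everywhere, which excludes \<open>m \<le> 0\<close>, and it dominates the real
  logarithm.\<close>

lemma ereal_expectation_eln_finite:
  assumes m: "m \<in> borel_measurable M" and le: "\<And>\<omega>. \<omega> \<in> space M \<Longrightarrow> m \<omega> \<le> 1"
    and fin: "ereal_expectation M (\<lambda>\<omega>. eln (m \<omega>)) > - \<infinity>"
  shows "AE \<omega> in M. 0 < m \<omega>" and "integrable M (\<lambda>\<omega>. - ln (max 0 (m \<omega>)))"
proof -
  note [measurable] = m
  let ?u = "\<lambda>\<omega>. e2ennreal (- eln (m \<omega>))"
  have u_eq: "?u \<omega> = (if m \<omega> \<le> 0 then \<infinity> else ennreal (- ln (m \<omega>)))" for \<omega>
    by (auto simp: eln_def ennreal.abs_eq)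
  have [measurable]: "?u \<in> borel_measurable M" unfolding u_eq by measurable
  have "(\<integral>\<^sup>+\<omega>. e2ennreal (eln (m \<omega>)) \<partial>M) = (\<integral>\<^sup>+\<omega>. 0 \<partial>M)"
    using le by (intro nn_integral_cong) (auto simp: eln_def e2ennreal_neg)
  with fin have u_fin: "(\<integral>\<^sup>+\<omega>. ?u \<omega> \<partial>M) \<noteq> \<infinity>"
    by (auto simp: ereal_expectation_def zero_ennreal.rep_eq)
  then have "AE \<omega> in M. ?u \<omega> \<noteq> \<infinity>"
    by (intro nn_integral_noteq_infinite) auto
  then show "AE \<omega> in M. 0 < m \<omega>"
    by eventually_elim (auto simp: u_eq split: if_splits)
  \<comment> \<open>Where \<open>m \<omega> \<le> 0\<close> the integrand is 0 because
    \<open>ln 0 = 0\<close>, so it is nonnegative and below \<open>?u\<close> everywhere.\<close>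
  show "integrable M (\<lambda>\<omega>. - ln (max 0 (m \<omega>)))"
  proof (rule integrableI_nonneg)
    show "AE \<omega> in M. 0 \<le> - ln (max 0 (m \<omega>))"
    proof (rule AE_I2)
      fix \<omega> assume "\<omega> \<in> space M"
      then show "0 \<le> - ln (max 0 (m \<omega>))" using le[of \<omega>] by (cases "m \<omega> = 0") (auto simp: max_def)
    qed
    have "(\<integral>\<^sup>+\<omega>. ennreal (- ln (max 0 (m \<omega>))) \<partial>M) \<le> (\<integral>\<^sup>+\<omega>. ?u \<omega> \<partial>M)"
      by (intro nn_integral_mono) (auto simp: u_eq max_def)
    then show "(\<integral>\<^sup>+\<omega>. ennreal (- ln (max 0 (m \<omega>))) \<partial>M) < \<infinity>"
      using u_fin by (simp add: less_top order_le_less_trans)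
  qed simp
qed

theorem theorem3:
  fixes M :: "'a measure"
    and T :: "'a \<Rightarrow> 'a"
    and F :: "nat \<Rightarrow> 'a measure"
    and r :: real
    and R Ls L :: "'a \<Rightarrow> real ^ 'k::finite"
  assumes "prob_space M"
    and "measure_preserving M T"
    and "ergodic M T"
    and "filtration (space M) F"
    and "\<And>t. subalgebra M (F t)"
    and "\<And>t \<Gamma>. \<Gamma> \<in> sets M \<Longrightarrow> T -` \<Gamma> \<inter> space M \<in> sets (F (Suc t)) \<longleftrightarrow> \<Gamma> \<in> sets (F t)"
    and "0 < r" and "r < 1"
    and "R \<in> space M \<rightarrow> unit_simplex"
    and "Ls \<in> space M \<rightarrow> unit_simplex"
    and "adapted F (stationary_process T R)"
    and "adapted F (stationary_process T Ls)"
    and "\<And>k. AE \<omega> in M.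
           r * real_cond_exp M (F 0) (\<lambda>\<omega>. Ls (T \<omega>) $ k) \<omega>
             + (1 - r) * real_cond_exp M (F 0) (\<lambda>\<omega>. R (T \<omega>) $ k) \<omega> = Ls \<omega> $ k"
    and K1: "ereal_expectation M (\<lambda>\<omega>. eln (MIN k. Ls \<omega> $ k)) > - \<infinity>"
    and K2: "cond_lin_indep M (F 0)
           (\<lambda>k \<omega>. r * stationary_process T Ls 1 \<omega> $ k + (1 - r) * stationary_process T R 1 \<omega> $ k)"
    and "L \<in> space M \<rightarrow> unit_simplex"
    and "adapted F (stationary_process T L)"
    and "\<not> (AE \<omega> in M. L \<omega> = Ls \<omega>)"
  shows "\<exists>(\<gamma> :: 'a \<Rightarrow> real) (c :: real).
           \<gamma> \<in> borel_measurable M \<and> (\<forall>\<omega>\<in>space M. \<gamma> \<omega> > 0) \<and> c < 0 \<and>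
           (AE \<omega> in M. \<forall>a. 0 \<le> a \<and> a \<le> \<gamma> \<omega> \<longrightarrow>
              limsup (\<lambda>t. ereal (1 / real t) * eln (wealth_ratio r T R Ls L a t \<omega>)) \<le> ereal c)"
proof -

  \<comment> \<open>Measurability of the three processes\<close>
  interpret prob_space M by fact
  note T = assms(2)
  note T_meas [measurable] = measure_preserving_measurable[OF T]
  note Tn_meas [measurable] = measurable_funpow[OF T_meas]
  have Tn_space: "(T ^^ t) \<omega> \<in> space M" if "\<omega> \<in> space M" for t \<omega>
    using measurable_space[OF Tn_meas that] .
  interpret F0: finite_measure_subalgebra M "F 0"
    by unfold_locales (rule assms(5))
  have time0: "f \<in> borel_measurable (F 0)" if "adapted F (stationary_process T f)" for f :: "'a \<Rightarrow> real ^ 'k"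
    using that by (auto simp: adapted_def stationary_process_def[abs_def] dest!: spec[of _ 0])
  have coord_F0: "(\<lambda>\<omega>. f \<omega> $ k) \<in> borel_measurable (F 0)"
    if "adapted F (stationary_process T f)" for f :: "'a \<Rightarrow> real ^ 'k" and k
    by (rule measurable_compose[OF time0[OF that]])
      (intro borel_measurable_continuous_onI continuous_intros)
  have coord_M: "(\<lambda>\<omega>. f \<omega> $ k) \<in> borel_measurable M"
    if "adapted F (stationary_process T f)" for f :: "'a \<Rightarrow> real ^ 'k" and k
    using measurable_from_subalg[OF assms(5) coord_F0[OF that]] .
  note F0_meas = coord_F0[OF assms(11)] coord_F0[OF assms(12)] coord_F0[OF assms(17)]
  note M_meas [measurable] = coord_M[OF assms(11)] coord_M[OF assms(12)] coord_M[OF assms(17)]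
  have simplex: "R \<omega> \<in> unit_simplex" "Ls \<omega> \<in> unit_simplex" "L \<omega> \<in> unit_simplex"
    if "\<omega> \<in> space M" for \<omega>
    using assms(9,10,16) that by auto

  \<comment> \<open>The minimal coordinate and (K1)\<close>
  define m where "m \<omega> = (MIN k. Ls \<omega> $ k)" for \<omega>
  have m_le: "m \<omega> \<le> Ls \<omega> $ k" for \<omega> k by (simp add: m_def)
  have m_le_1: "m \<omega> \<le> 1" if "\<omega> \<in> space M" for \<omega>
    using m_le unit_simplexD(2)[OF simplex(2)[OF that]] by (rule order_trans)
  have [measurable]: "m \<in> borel_measurable M"
    unfolding m_def[abs_def] by (rule borel_measurable_Min) auto
  \<comment> \<open>Where \<open>m\<close> is positive, \<open>1 / m = exp h\<close>; sublinear
    growth of \<open>h\<close> along orbits thus controls the perturbation weights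
    \<open>1 / m\<close>.\<close>
  define h where "h \<omega> = - ln (max 0 (m \<omega>))" for \<omega>
  have m_pos: "AE \<omega> in M. 0 < m \<omega>" and h_int: "integrable M h"
    using ereal_expectation_eln_finite[of m M] m_le_1 K1 by (auto simp: m_def[abs_def] h_def[abs_def])
  have [measurable]: "h \<in> borel_measurable M" using h_int by simp

  \<comment> \<open>The variables \<mu> and their conditional means\<close>
  define \<mu> where "\<mu> k \<omega> = r * Ls (T \<omega>) $ k + (1 - r) * R (T \<omega>) $ k" for k \<omega>
  have [measurable]: "\<mu> k \<in> borel_measurable M" for k
    unfolding \<mu>_def[abs_def] by measurable
  have conv: "0 \<le> r * Ls \<omega> $ k + (1 - r) * R \<omega> $ k" "0 \<le> r * L \<omega> $ k + (1 - r) * R \<omega> $ k"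
      "(\<Sum>k\<in>UNIV. r * Ls \<omega> $ k + (1 - r) * R \<omega> $ k) = 1"
      "(\<Sum>k\<in>UNIV. r * L \<omega> $ k + (1 - r) * R \<omega> $ k) = 1"
    if "\<omega> \<in> space M" for \<omega> k
    using assms(7,8) unit_simplexD[OF simplex(1)[OF that]] unit_simplexD[OF simplex(2)[OF that]]
      unit_simplexD[OF simplex(3)[OF that]]
    by (simp_all add: sum.distrib sum_distrib_left[symmetric])
  have \<mu>_nonneg: "0 \<le> \<mu> k \<omega>" and \<mu>_sum: "(\<Sum>k\<in>UNIV. \<mu> k \<omega>) = 1" if "\<omega> \<in> space M" for k \<omega>
    using conv[OF measurable_space[OF T_meas that]] by (auto simp: \<mu>_def)
  have coord_int: "integrable M (\<lambda>\<omega>. f (T \<omega>) $ k)"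
    if f: "f \<in> space M \<rightarrow> unit_simplex" "adapted F (stationary_process T f)" for f :: "'a \<Rightarrow> real ^ 'k" and k
  proof (rule integrable_const_bound[where B = 1])
    show "AE \<omega> in M. norm (f (T \<omega>) $ k) \<le> 1"
    proof (rule AE_I2)
      fix \<omega> assume "\<omega> \<in> space M"
      then have "f (T \<omega>) \<in> unit_simplex" using f(1) measurable_space[OF T_meas] by blast
      from unit_simplexD(1,2)[OF this, of k] show "norm (f (T \<omega>) $ k) \<le> 1" by simp
    qed
    show "(\<lambda>\<omega>. f (T \<omega>) $ k) \<in> borel_measurable M"
      using measurable_compose[OF T_meas coord_M[OF f(2)]] .
  qed
  note Ls_int = coord_int[OF assms(10,12)] and R_int = coord_int[OF assms(9,11)]
  have \<mu>_int: "integrable M (\<mu> k)" for k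
    unfolding \<mu>_def[abs_def] using Ls_int R_int by simp
  have \<mu>_cond: "AE \<omega> in M. real_cond_exp M (F 0) (\<mu> k) \<omega> = Ls \<omega> $ k" for k
  proof -
    have "AE \<omega> in M. real_cond_exp M (F 0) (\<mu> k) \<omega> = real_cond_exp M (F 0) (\<lambda>\<omega>. r * Ls (T \<omega>) $ k) \<omega>
        + real_cond_exp M (F 0) (\<lambda>\<omega>. (1 - r) * R (T \<omega>) $ k) \<omega>"
      unfolding \<mu>_def[abs_def] using Ls_int R_int by (intro F0.real_cond_exp_add) auto
    with F0.real_cond_exp_cmult[OF Ls_int, of r k] F0.real_cond_exp_cmult[OF R_int, of "1 - r" k] assms(13)[of k]
    show ?thesis by eventually_elim simp
  qed

  \<comment> \<open>The linearised growth factor has mean one\<close>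
  define d where "d \<omega> = (\<Sum>k\<in>UNIV. \<mu> k \<omega> * (L \<omega> $ k / Ls \<omega> $ k))" for \<omega>
  have [measurable]: "d \<in> borel_measurable M" unfolding d_def[abs_def] by measurable
  have ratio_nonneg: "0 \<le> L \<omega> $ k / Ls \<omega> $ k" if "\<omega> \<in> space M" for \<omega> k
    using unit_simplexD(1)[OF simplex(2)[OF that]] unit_simplexD(1)[OF simplex(3)[OF that]] by simp
  have d_nonneg: "0 \<le> d \<omega>" if "\<omega> \<in> space M" for \<omega>
    unfolding d_def using \<mu>_nonneg[OF that] ratio_nonneg[OF that] by (intro sum_nonneg mult_nonneg_nonneg)
  \<comment> \<open>The ratios are measurable with respect to \<open>F 0\<close> but possibly
    unbounded, so the mean is computed with nonnegative integrals. Integrability of \<open>d\<close>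
    then comes out as a consequence.\<close>
  have "(\<integral>\<^sup>+\<omega>. ennreal (d \<omega>) \<partial>M)
      = (\<integral>\<^sup>+\<omega>. (\<Sum>k\<in>UNIV. ennreal (L \<omega> $ k / Ls \<omega> $ k) * ennreal (\<mu> k \<omega>)) \<partial>M)"
  proof (rule nn_integral_cong)
    fix \<omega> assume \<omega>: "\<omega> \<in> space M"
    have "ennreal (d \<omega>) = (\<Sum>k\<in>UNIV. ennreal (L \<omega> $ k / Ls \<omega> $ k * \<mu> k \<omega>))"
      unfolding d_def using mult_nonneg_nonneg[OF ratio_nonneg[OF \<omega>] \<mu>_nonneg[OF \<omega>]]
      by (subst sum_ennreal) (simp_all only: mult.commute[of "\<mu> _ _"])
    also have "\<dots> = (\<Sum>k\<in>UNIV. ennreal (L \<omega> $ k / Ls \<omega> $ k) * ennreal (\<mu> k \<omega>))"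
      by (intro sum.cong refl ennreal_mult \<mu>_nonneg[OF \<omega>] ratio_nonneg[OF \<omega>])
    finally show "ennreal (d \<omega>) = (\<Sum>k\<in>UNIV. ennreal (L \<omega> $ k / Ls \<omega> $ k) * ennreal (\<mu> k \<omega>))" .
  qed
  also have "\<dots> = (\<Sum>k\<in>UNIV. \<integral>\<^sup>+\<omega>. ennreal (L \<omega> $ k / Ls \<omega> $ k) * ennreal (\<mu> k \<omega>) \<partial>M)"
    by (intro nn_integral_sum) auto
  also have "\<dots> = (\<Sum>k\<in>UNIV. \<integral>\<^sup>+\<omega>. ennreal (L \<omega> $ k) \<partial>M)"
  proof (intro sum.cong refl)
    fix k
    have "(\<integral>\<^sup>+\<omega>. ennreal (L \<omega> $ k / Ls \<omega> $ k) * ennreal (\<mu> k \<omega>) \<partial>M)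
        = (\<integral>\<^sup>+\<omega>. ennreal (L \<omega> $ k / Ls \<omega> $ k) * ennreal (real_cond_exp M (F 0) (\<mu> k) \<omega>) \<partial>M)"
      by (rule nn_integral_mult_real_cond_exp[symmetric])
        (use F0.sigma_finite_subalgebra_axioms \<mu>_int \<mu>_nonneg F0_meas in auto)
    also have "\<dots> = (\<integral>\<^sup>+\<omega>. ennreal (L \<omega> $ k) \<partial>M)"
    proof (rule nn_integral_cong_AE)
      show "AE \<omega> in M. ennreal (L \<omega> $ k / Ls \<omega> $ k) * ennreal (real_cond_exp M (F 0) (\<mu> k) \<omega>) = ennreal (L \<omega> $ k)"
        using \<mu>_cond[of k] m_pos AE_space
      proof eventually_elim
        case (elim \<omega>)
        then have "0 < Ls \<omega> $ k" using m_le[of \<omega> k] by linarith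
        then show ?case
          using elim ratio_nonneg[of \<omega> k] by (simp add: ennreal_mult[symmetric])
      qed
    qed
    finally show "(\<integral>\<^sup>+\<omega>. ennreal (L \<omega> $ k / Ls \<omega> $ k) * ennreal (\<mu> k \<omega>) \<partial>M) = (\<integral>\<^sup>+\<omega>. ennreal (L \<omega> $ k) \<partial>M)" .
  qed
  also have "\<dots> = (\<integral>\<^sup>+\<omega>. (\<Sum>k\<in>UNIV. ennreal (L \<omega> $ k)) \<partial>M)"
    by (intro nn_integral_sum[symmetric]) auto
  also have "\<dots> = (\<integral>\<^sup>+\<omega>. 1 \<partial>M)"
    using unit_simplexD(1,3)[OF simplex(3)] by (intro nn_integral_cong) (subst sum_ennreal; simp)
  finally have d_nn: "(\<integral>\<^sup>+\<omega>. ennreal (d \<omega>) \<partial>M) = ennreal 1" by (simp add: emeasure_space_1)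
  have d_int: "integrable M d" and d_eq: "(\<integral>\<omega>. d \<omega> \<partial>M) = 1"
    using nn_integral_eq_integrable[of d M 1] d_nn d_nonneg by auto

  \<comment> \<open>The truncated logarithmic growth rate is strictly negative\<close>
  define g where "g \<omega> = ln (max (d \<omega>) (exp (- 2)))" for \<omega>
  have [measurable]: "g \<in> borel_measurable M" unfolding g_def[abs_def] by measurable
  have g_le: "g \<omega> \<le> d \<omega> - 1" if "\<omega> \<in> space M" for \<omega>
    unfolding g_def using d_nonneg[OF that] by (rule ln_max_exp_le)
  have g_ge: "- 2 \<le> g \<omega>" for \<omega>
  proof -
    have "ln (exp (- 2)) \<le> g \<omega>" unfolding g_def by (subst ln_le_cancel_iff) (auto simp: less_max_iff_disj)
    then show ?thesis by simp
  qed
  have d_le_exp: "d \<omega> \<le> exp (g \<omega>)" for \<omega>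
    unfolding g_def by (subst exp_ln) (auto simp: less_max_iff_disj)
  have g_int: "integrable M g"
  proof (rule Bochner_Integration.integrable_bound[of M "\<lambda>\<omega>. d \<omega> + 2"])
    show "AE \<omega> in M. norm (g \<omega>) \<le> norm (d \<omega> + 2)"
    proof (rule AE_I2)
      fix \<omega> assume "\<omega> \<in> space M"
      then show "norm (g \<omega>) \<le> norm (d \<omega> + 2)"
        using g_le[of \<omega>] g_ge[of \<omega>] d_nonneg[of \<omega>] by (simp add: abs_le_iff)
    qed
  qed (use d_int in auto)
  have g_neg: "(\<integral>\<omega>. g \<omega> \<partial>M) < 0"
  \<comment> \<open>The gap \<open>d - 1 - g\<close> is nonnegative with integral
    \<open>- E g\<close>. If \<open>E g\<close> were not negative, the gap would vanish almost
    surely, which is the equality case \<open>d = 1\<close>.\<close>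
  proof (rule ccontr)
    assume "\<not> (\<integral>\<omega>. g \<omega> \<partial>M) < 0"
    moreover have "(\<integral>\<omega>. d \<omega> - 1 - g \<omega> \<partial>M) = - (\<integral>\<omega>. g \<omega> \<partial>M)"
      using d_int g_int by (simp add: d_eq prob_space)
    moreover have "0 \<le> (\<integral>\<omega>. d \<omega> - 1 - g \<omega> \<partial>M)"
      using g_le by (intro integral_nonneg_AE AE_I2) auto
    ultimately have "(\<integral>\<omega>. d \<omega> - 1 - g \<omega> \<partial>M) = 0" by linarith
    then have "AE \<omega> in M. d \<omega> - 1 - g \<omega> = 0"
      using d_int g_int g_le by (subst (asm) integral_nonneg_eq_0_iff_AE) auto
    then have d1: "AE \<omega> in M. d \<omega> = 1"
      using AE_space
    proof eventually_elim
      case (elim \<omega>)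
      then show ?case using ln_max_exp_le(2)[OF d_nonneg[OF elim(2)]] by (simp add: g_def)
    qed
    define \<alpha> where "\<alpha> k \<omega> = L \<omega> $ k / Ls \<omega> $ k - 1" for k \<omega>
    have "\<alpha> k \<in> borel_measurable (F 0)" for k
      unfolding \<alpha>_def[abs_def] using F0_meas by measurable
    moreover have "AE \<omega> in M. (\<Sum>k\<in>UNIV. \<alpha> k \<omega> * \<mu> k \<omega>) = 0"
      using d1 AE_space
    proof eventually_elim
      case (elim \<omega>)
      have "(\<Sum>k\<in>UNIV. \<alpha> k \<omega> * \<mu> k \<omega>) = d \<omega> - (\<Sum>k\<in>UNIV. \<mu> k \<omega>)"
        unfolding d_def sum_subtractf[symmetric] by (intro sum.cong) (auto simp: \<alpha>_def algebra_simps)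
      then show ?case using elim \<mu>_sum by simp
    qed
    moreover have "\<mu> = (\<lambda>k \<omega>. r * stationary_process T Ls 1 \<omega> $ k + (1 - r) * stationary_process T R 1 \<omega> $ k)"
      by (simp add: \<mu>_def[abs_def] stationary_process_def)
    ultimately have "AE \<omega> in M. \<alpha> k \<omega> = 0" for k
      using K2 unfolding cond_lin_indep_def by blast
    then have "AE \<omega> in M. \<forall>k. \<alpha> k \<omega> = 0" by (simp add: AE_all_countable)
    with m_pos have "AE \<omega> in M. L \<omega> = Ls \<omega>"
    proof eventually_elim
      case (elim \<omega>)
      then have "L \<omega> $ k = Ls \<omega> $ k" for k
        using m_le[of \<omega> k] by (auto simp: \<alpha>_def dest!: spec[of _ k])
      then show ?case by (simp add: vec_eq_iff)
    qed
    with assms(18) show False by simp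
  qed

  \<comment> \<open>Orbitwise bounds with a common constant\<close>
  \<comment> \<open>The mean of \<open>g\<close> is \<open>- 3 * \<epsilon>\<close>: adding
    \<open>2 * \<epsilon>\<close> keeps it negative, so the sums of \<open>g\<close> decay at rate
    \<open>2 * \<epsilon>\<close>, which beats the growth rate \<epsilon> allowed to
    \<open>h\<close>.\<close>
  define \<epsilon> where "\<epsilon> = - (\<integral>\<omega>. g \<omega> \<partial>M) / 3"
  have \<epsilon>: "0 < \<epsilon>" using g_neg by (simp add: \<epsilon>_def)
  define good where "good C \<omega> \<longleftrightarrow> (\<forall>n. (\<Sum>i<n. g ((T ^^ i) \<omega>) + 2 * \<epsilon>) \<le> real C) \<and>
      (\<forall>n. h ((T ^^ n) \<omega>) \<le> real C + \<epsilon> * real n)" for C :: nat and \<omega>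
  have "AE \<omega> in M. \<exists>C::nat. \<forall>n. (\<Sum>i<n. g ((T ^^ i) \<omega>) + 2 * \<epsilon>) \<le> real C"
  proof (rule ergodic_sums_bounded_above[OF assms(1-3)])
    show "(\<integral>\<omega>. g \<omega> + 2 * \<epsilon> \<partial>M) < 0" using g_int g_neg by (simp add: prob_space \<epsilon>_def)
  qed (use g_int in simp)
  moreover have "AE \<omega> in M. \<exists>C::nat. \<forall>n. h ((T ^^ n) \<omega>) \<le> real C + \<epsilon> * real n"
    by (rule ergodic_sublinear[OF assms(1-3) h_int \<epsilon>])
  ultimately have good_ex: "AE \<omega> in M. \<exists>C. good C \<omega>"
  proof eventually_elim
    case (elim \<omega>)
    then obtain C D :: nat where CD: "\<And>n. (\<Sum>i<n. g ((T ^^ i) \<omega>) + 2 * \<epsilon>) \<le> real C"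
      "\<And>n. h ((T ^^ n) \<omega>) \<le> real D + \<epsilon> * real n" by blast
    have "good (C + D) \<omega>"
      unfolding good_def
    proof (intro conjI allI)
      fix n
      show "(\<Sum>i<n. g ((T ^^ i) \<omega>) + 2 * \<epsilon>) \<le> real (C + D)" using CD(1)[of n] by simp
      show "h ((T ^^ n) \<omega>) \<le> real (C + D) + \<epsilon> * real n" using CD(2)[of n] by simp
    qed
    then show ?case by blast
  qed
  have [measurable]: "Measurable.pred M (good C)" for C
    unfolding good_def[abs_def] by measurable

  \<comment> \<open>The random threshold and the decay of the wealth ratio\<close>
  \<comment> \<open>This is the smallness condition of \<open>perturbed_product_decay\<close> with
    \<open>b\<close> the least admissible constant. Taking \<open>C\<close> in the natural numbers
    makes the choice measurable; where no \<open>C\<close> is good, \<open>LEAST\<close> still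
    denotes some number, so \<gamma> remains positive.\<close>
  define \<gamma> where "\<gamma> \<omega> = (1 - exp (- \<epsilon>)) * exp (- 2 * real (LEAST C. good C \<omega>) - 1)" for \<omega>
  have "AE \<omega> in M. \<forall>a. 0 \<le> a \<and> a \<le> \<gamma> \<omega> \<longrightarrow>
      limsup (\<lambda>t. ereal (1 / real t) * eln (wealth_ratio r T R Ls L a t \<omega>)) \<le> ereal (- \<epsilon>)"
    \<comment> \<open>None of these events involves \<open>a\<close>, so one null set serves all
      initial values.\<close>
    using good_ex AE_funpow[OF T m_pos] AE_space
  proof eventually_elim
    case (elim \<omega>)
    define C where "C = (LEAST C. good C \<omega>)"
    have "good C \<omega>" unfolding C_def using elim(1) by (rule LeastI_ex)
    then have gS: "(\<Sum>i<n. g ((T ^^ i) \<omega>)) \<le> real C - 2 * \<epsilon> * real n"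
      and hS: "h ((T ^^ n) \<omega>) \<le> real C + \<epsilon> * real n" for n
      by (auto simp: good_def sum.distrib algebra_simps)
    show ?case
    proof (intro allI impI)
      fix a assume a: "0 \<le> a \<and> a \<le> \<gamma> \<omega>"
      define x where "x t = wealth_ratio r T R Ls L a t \<omega>" for t
      let ?w = "\<lambda>t. 1 / m ((T ^^ t) \<omega>)"
      \<comment> \<open>Nonnegativity is included because the upper bound requires it at time
        \<open>t\<close>; the induction for \<open>x_nonneg\<close> passes it on.\<close>
      have step: "0 \<le> x (Suc t) \<and> x (Suc t) \<le> x t * d ((T ^^ t) \<omega>) * (1 + x t * ?w t)" if "0 \<le> x t" for t
      proof -
        let ?\<omega> = "(T ^^ t) \<omega>"
        have sp: "?\<omega> \<in> space M" "T ?\<omega> \<in> space M"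
          using Tn_space[OF elim(3), of t] Tn_space[OF elim(3), of "Suc t"] by auto
        have "x (Suc t) = x t * ((\<Sum>k\<in>UNIV. \<mu> k ?\<omega> * (L ?\<omega> $ k / (L ?\<omega> $ k * x t + Ls ?\<omega> $ k))) /
            (\<Sum>k\<in>UNIV. (r * L (T ?\<omega>) $ k + (1 - r) * R (T ?\<omega>) $ k) * (Ls ?\<omega> $ k / (L ?\<omega> $ k * x t + Ls ?\<omega> $ k))))"
          by (simp add: x_def Let_def stationary_process_def \<mu>_def)
        then show ?thesis
          unfolding d_def
          using wealth_ratio_step_bound[of "x t" "m ?\<omega>" "\<lambda>k. Ls ?\<omega> $ k" "\<lambda>k. L ?\<omega> $ k" "\<lambda>k. \<mu> k ?\<omega>"
              "\<lambda>k. r * L (T ?\<omega>) $ k + (1 - r) * R (T ?\<omega>) $ k"]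
            that elim(2) m_le unit_simplexD(1,2)[OF simplex(3)[OF sp(1)]] \<mu>_nonneg[OF sp(1)] conv(2,4)[OF sp(2)]
          by simp
      qed
      have x_nonneg: "0 \<le> x t" for t
        by (induction t) (use a step in \<open>auto simp: x_def simp del: wealth_ratio.simps(2)\<close>)
      have w_nonneg: "0 \<le> ?w t" for t using elim(2) by (simp add: less_imp_le)
      have bound: "x t \<le> x 0 * exp ((\<Sum>i<t. g ((T ^^ i) \<omega>)) + (1 - exp (- \<epsilon>) ^ t))" for t
      proof (rule perturbed_product_decay[where b = "real C" and w = ?w])
        show "x (Suc t) \<le> x t * exp (g ((T ^^ t) \<omega>)) * (1 + x t * ?w t)" for t
        proof -
          have "x t * d ((T ^^ t) \<omega>) * (1 + x t * ?w t) \<le> x t * exp (g ((T ^^ t) \<omega>)) * (1 + x t * ?w t)"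
            by (intro mult_right_mono mult_left_mono d_le_exp add_nonneg_nonneg mult_nonneg_nonneg x_nonneg w_nonneg) auto
          with step[OF x_nonneg, of t] show ?thesis by linarith
        qed
        show "?w t \<le> exp (real C + \<epsilon> * real t)" for t
        proof -
          have "?w t = exp (h ((T ^^ t) \<omega>))"
            using elim(2) by (simp add: h_def exp_minus max_def less_imp_le divide_inverse)
          then show ?thesis using hS[of t] by simp
        qed
        show "x 0 \<le> (1 - exp (- \<epsilon>)) * exp (- 2 * real C - 1)"
          using a by (simp add: x_def \<gamma>_def C_def)
      qed (use x_nonneg w_nonneg gS in auto)
      have x0_le_1: "x 0 \<le> 1"
      proof -
        have "\<gamma> \<omega> \<le> 1 * 1" unfolding \<gamma>_def using \<epsilon> by (intro mult_mono) auto
        then show ?thesis using a by (simp add: x_def)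
      qed
      have x_le: "x t \<le> exp (real C + 1 - 2 * \<epsilon> * real t)" for t
      proof -
        have "x t \<le> 1 * exp ((\<Sum>i<t. g ((T ^^ i) \<omega>)) + (1 - exp (- \<epsilon>) ^ t))"
          using bound[of t] x0_le_1 by (rule order_trans[OF _ mult_right_mono]) auto
        also have "\<dots> \<le> exp (real C + 1 - 2 * \<epsilon> * real t)"
          using gS[of t] zero_le_power[of "exp (- \<epsilon>)" t] by (simp del: zero_le_power)
        finally show ?thesis .
      qed
      \<comment> \<open>From time \<open>N\<close> on, the constant \<open>C + 1\<close> is absorbed
        by half of the decay \<open>2 * \<epsilon> * t\<close>. Starting at \<open>Suc N\<close>
        excludes \<open>t = 0\<close>, where \<open>1 / real t\<close> is 0.\<close>
      obtain N :: nat where N: "(real C + 1) / \<epsilon> \<le> real N" using real_arch_simple by blast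
      have "\<forall>\<^sub>F t in sequentially. ereal (1 / real t) * eln (x t) \<le> ereal (- \<epsilon>)"
      proof (rule eventually_sequentiallyI[of "Suc N"])
        fix t assume "Suc N \<le> t"
        then have t: "0 < real t" "(real C + 1) / \<epsilon> \<le> real t" using N by auto
        show "ereal (1 / real t) * eln (x t) \<le> ereal (- \<epsilon>)"
        proof (cases "x t \<le> 0")
          \<comment> \<open>The sequence may reach 0, for instance when \<open>a = 0\<close>; then
            \<open>eln\<close> is minus infinity, and so is its product with the positive factor
            \<open>1 / real t\<close>.\<close>
          case True
          then show ?thesis using t(1) by (simp add: eln_def)
        next
          case False
          then have "ln (x t) \<le> ln (exp (real C + 1 - 2 * \<epsilon> * real t))"
            using x_le[of t] by (subst ln_le_cancel_iff) auto
          also have "\<dots> \<le> - \<epsilon> * real t"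
            using t(2) \<epsilon> by (simp add: divide_le_eq algebra_simps)
          finally have "1 / real t * ln (x t) \<le> - \<epsilon>"
            using t(1) by (simp add: divide_le_eq)
          then show ?thesis using False by (simp add: eln_def)
        qed
      qed
      then show "limsup (\<lambda>t. ereal (1 / real t) * eln (wealth_ratio r T R Ls L a t \<omega>)) \<le> ereal (- \<epsilon>)"
        unfolding x_def by (rule Limsup_bounded)
    qed
  qed
  moreover have "\<gamma> \<in> borel_measurable M" unfolding \<gamma>_def[abs_def] by measurable
  moreover have "\<forall>\<omega>\<in>space M. \<gamma> \<omega> > 0" using \<epsilon> by (simp add: \<gamma>_def)
  ultimately show ?thesis
    using \<epsilon> by (intro exI[of _ \<gamma>] exI[of _ "- \<epsilon>"]) simp
qed

end
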